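(* Let $d \geq 1$ be an integer and let $F : \mathbb{R} \to \mathbb{R}$ be a function. Then $F[-]$ maps $\mathcal{M}([-1,1]^d)$ into itself if and only if $F$ is absolutely monotonic and entire, that is, $F$ is the restriction to $\mathbb{R}$ of an entire function with non-negative Taylor coefficients at $0$.
   Context: An admissible measure on $\mathbb{R}^d$ is a non-negative measure $\mu$ on $\mathbb{R}^d$ with moments of all orders; its moment family is $(s_\alpha(\mu))_{\alpha \in \mathbb{Z}_+^d}$, where $\mathbb{Z}_+ = \{0,1,2,\dots\}$, $s_\alpha(\mu) := \int \mathbf{x}^\alpha \, d\mu(\mathbf{x})$ and $\mathbf{x}^\alpha = x_1^{\alpha_1}\cdots x_d^{\alpha_d}$. For $K \subset \mathbb{R}^d$, $\mathcal{M}(K)$ is the set of moment families of admissible measures supported on $K$. $F[-]$ acts entrywise: $F[(s_\alpha)_{\alpha}] := (F(s_\alpha))_{\alpha}$. *)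

theory Defs
  imports "HOL-Complex_Analysis.Complex_Analysis"
begin

definition monomial :: "nat ^ 'd \<Rightarrow> real ^ 'd \<Rightarrow> real" where
  "monomial \<alpha> x = (\<Prod>i\<in>UNIV. (x $ i) ^ (\<alpha> $ i))"

text \<open>Measures are Borel measures. The case of the zero multi-index forces an admissible measure
  to be finite; the zero measure is admissible.\<close>

definition admissible :: "(real ^ 'd) measure \<Rightarrow> bool" where
  "admissible M \<longleftrightarrow> sets M = sets borel \<and> (\<forall>\<alpha>. integrable M (monomial \<alpha>))"

definition moment :: "(real ^ 'd) measure \<Rightarrow> nat ^ 'd \<Rightarrow> real" where
  "moment M \<alpha> = (\<integral>x. monomial \<alpha> x \<partial>M)"

text \<open>A measure is supported on \<open>K\<close> if the complement of \<open>K\<close> is a null set. For closed \<open>K\<close> this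
  says exactly that the topological support is contained in \<open>K\<close>.\<close>

definition supported_on :: "(real ^ 'd) measure \<Rightarrow> (real ^ 'd) set \<Rightarrow> bool" where
  "supported_on M K \<longleftrightarrow> (AE x in M. x \<in> K)"

definition moment_families :: "(real ^ 'd) set \<Rightarrow> (nat ^ 'd \<Rightarrow> real) set" where
  "moment_families K = {moment M | M. admissible M \<and> supported_on M K}"

definition entrywise :: "(real \<Rightarrow> real) \<Rightarrow> (nat ^ 'd \<Rightarrow> real) \<Rightarrow> (nat ^ 'd \<Rightarrow> real)" where
  "entrywise F s = (\<lambda>\<alpha>. F (s \<alpha>))"

definition unit_cube :: "(real ^ 'd) set" where
  "unit_cube = {x. \<forall>i. x $ i \<in> {-1..1}}"

text \<open>Membership in \<open>\<real>\<^sub>\<ge>\<^sub>0\<close> says that the a priori complex Taylor coefficient is real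
  and non-negative.\<close>

definition abs_monotonic_entire :: "(real \<Rightarrow> real) \<Rightarrow> bool" where
  "abs_monotonic_entire F \<longleftrightarrow>
     (\<exists>f :: complex \<Rightarrow> complex. f holomorphic_on UNIV \<and>
        (\<forall>x. f (complex_of_real x) = complex_of_real (F x)) \<and>
        (\<forall>n. (deriv ^^ n) f 0 / fact n \<in> \<real>\<^sub>\<ge>\<^sub>0))"

end

theory Submission
  imports Defs "HOL-Probability.Giry_Monad"
begin

text \<open>
  Sufficiency. Moments turn coordinatewise products of independent vectors into products: if
  \<open>\<mu>\<close> has moments \<open>s\<close>, its \<open>n\<close>-fold multiplicative convolution power has moments \<open>s ^ n\<close> and
  still lives on the cube, which is closed under multiplication. For \<open>F x = (\<Sum>n. c n * x ^ n)\<close>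
  with \<open>c n \<ge> 0\<close>, the mixture of these powers with weights \<open>c n\<close> has moments \<open>F s\<close>
  (\<open>abs_monotonic_entire_preserves_moment_families\<close>).

  Necessity. Apply the hypothesis to the measure with masses \<open>(u + v) / 2\<close>, \<open>(u - v) / 2\<close> and \<open>s\<close>
  at the points \<open>1\<close>, \<open>-1\<close> and \<open>q\<close> of the diagonal. Its moments of even total degree \<open>k\<close> are
  \<open>u + s * q ^ k\<close>, those of odd degree are \<open>v + s * q ^ k\<close>. Integrating the polynomials
  \<open>r (t\<^sup>2) * (1 \<plusminus> t)\<close>, with \<open>r \<ge> 0\<close> on \<open>[0, 1]\<close>, against the measure representing the transformed
  moments shows that a linear combination of values of \<open>F\<close> near \<open>v\<close> is dominated by the
  corresponding combination near \<open>u\<close> whenever \<open>\<bar>v\<bar> \<le> u\<close>. This is the property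
  \<open>paired_positive\<close>; only it is used from then on.

  The polynomial \<open>r = (\<Prod>i<n. (t - q ^ (2 * i))\<^sup>2)\<close> kills all Taylor terms of order below \<open>n\<close>
  in \<open>s\<close>, because the \<open>m\<close>-th one is a multiple of \<open>r (q ^ (2 * m))\<close>. For smooth \<open>F\<close>, dividing by
  \<open>s ^ n\<close> and letting \<open>s \<rightarrow> 0\<close>, then \<open>q \<rightarrow> 1\<close>, leaves \<open>\<bar>F\<^sup>(\<^sup>n\<^sup>) v\<bar> \<le> F\<^sup>(\<^sup>n\<^sup>) u\<close> for \<open>\<bar>v\<bar> \<le> u\<close>
  (\<open>paired_positive_derivative_abs_le\<close>). Hence all derivatives are non-negative on the positive
  half-line and control those on the negative one, and Taylor's formula with remainder shows
  that the Maclaurin polynomials converge on the whole line (\<open>maclaurin_approximation\<close>).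

  A general \<open>F\<close> is first seen to be continuous. Averaging over short intervals to the right
  keeps the property and gains one derivative, so \<open>N\<close> averages over intervals of
  length \<open>1 / (N + 1)\<^sup>2\<close> give approximations of \<open>F\<close> with \<open>N\<close> derivatives. Their Maclaurin polynomials
  have non-negative coefficients, converge to \<open>F\<close> on the real line and are locally bounded on
  the complex plane; Montel's theorem extracts an entire limit
  (\<open>paired_positive_imp_abs_monotonic_entire\<close>).
\<close>

section \<open>Domination of a function by its values on the positive half-line\<close>

text \<open>
  The trace on \<open>F\<close> of the three-point test measures: the even moments see \<open>u\<close>, the odd ones \<open>v\<close>,
  and the absolute value combines the two test polynomials \<open>r (t\<^sup>2) * (1 \<plusminus> t)\<close>.
\<close>
definition paired_positive :: "(real \<Rightarrow> real) \<Rightarrow> bool" where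
  "paired_positive F \<longleftrightarrow>
     (\<forall>r. (\<forall>t\<in>{0..1}. 0 \<le> poly r t) \<longrightarrow>
       (\<forall>u v s q. \<bar>v\<bar> \<le> u \<and> 0 \<le> s \<and> 0 \<le> q \<and> q \<le> 1 \<longrightarrow>
         \<bar>\<Sum>k\<le>degree r. coeff r k * F (v + s * q ^ (2 * k + 1))\<bar>
           \<le> (\<Sum>k\<le>degree r. coeff r k * F (u + s * q ^ (2 * k)))))"

lemma paired_positiveD:
  assumes "paired_positive F" "\<And>t. 0 \<le> t \<Longrightarrow> t \<le> 1 \<Longrightarrow> 0 \<le> poly r t"
    and "\<bar>v\<bar> \<le> u" "0 \<le> s" "0 \<le> q" "q \<le> 1"
  shows "\<bar>\<Sum>k\<le>degree r. coeff r k * F (v + s * q ^ (2 * k + 1))\<bar>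
           \<le> (\<Sum>k\<le>degree r. coeff r k * F (u + s * q ^ (2 * k)))"
  using assms unfolding paired_positive_def by auto

lemma paired_positive_abs_le:
  assumes "paired_positive F" "\<bar>v\<bar> \<le> u"
  shows "\<bar>F v\<bar> \<le> F u"
  using paired_positiveD[OF assms(1), of 1 v u 0 0] assms(2) by simp

text \<open>
  The case \<open>r = 1 - t\<close>, \<open>q = 1 / 2\<close>: increments of \<open>F\<close> anywhere are bounded by increments of
  comparable length further to the right.
\<close>
lemma paired_positive_increment_le:
  assumes F: "paired_positive F" and uv: "\<bar>v\<bar> \<le> u" and s: "0 \<le> s"
  shows "\<bar>F (v + s / 2) - F (v + s / 8)\<bar> \<le> F (u + s) - F u"
proof -
  have "\<bar>F (v + s / 2) - F (v + s / 8)\<bar> \<le> F (u + s) - F (u + s / 4)"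
    using paired_positiveD[OF F, of "[:1, -1:]" v u s "1/2"] uv s
    by (simp add: eval_nat_numeral)
  moreover have "F u \<le> F (u + s / 4)"
    using paired_positive_abs_le[OF F, of u "u + s / 4"] uv s by force
  ultimately show ?thesis by linarith
qed

text \<open>
  The base point \<open>u\<close> in the previous bound is free. Placing \<open>N\<close> adjacent intervals in
  \<open>[U, U + 1]\<close> and summing, the right-hand sides telescope to at most \<open>F (U + 1)\<close>, while the
  left-hand side is the same each time. So an increment of \<open>F\<close> over a length of at most
  \<open>1 / (3 * N)\<close> is at most \<open>F (U + 1) / N\<close>.
\<close>
lemma paired_positive_continuous:
  assumes F: "paired_positive F"
  shows "isCont F x"
proof -
  define U where "U = \<bar>x\<bar> + 2"
  have step: "real N * \<bar>F b - F a\<bar> \<le> F (U + 1)"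
    if ab: "a < b" "\<bar>a - x\<bar> < 1" and N: "3 * real N * (b - a) \<le> 1" "0 < N" for a b N
  proof -
    \<comment> \<open>chosen so that \<open>s / 2 - s / 8 = b - a\<close>\<close>
    define s where "s = 8 * (b - a) / 3"
    have "1 * (3 * (b - a)) \<le> real N * (3 * (b - a))"
      using ab N by (intro mult_right_mono) auto
    then have ba: "b - a \<le> 1 / 3" using N by (simp add: algebra_simps)
    have s: "0 \<le> s" "s \<le> 1"
      using ab ba by (auto simp: s_def)
    have "real N * s = 8 / 9 * (3 * real N * (b - a))" by (simp add: s_def)
    also have "\<dots> \<le> 1" using N by simp
    finally have Ns: "real N * s \<le> 1" .
    have le: "\<bar>F b - F a\<bar> \<le> F (U + real (Suc j) * s) - F (U + real j * s)" for j
    proof -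
      have "0 \<le> real j * s" using s by simp
      moreover have "\<bar>a - s / 8\<bar> \<le> U" using s ab unfolding U_def by linarith
      ultimately have "\<bar>a - s / 8\<bar> \<le> U + real j * s" by linarith
      from paired_positive_increment_le[OF F this s(1)] show ?thesis
        by (simp add: s_def algebra_simps add_divide_distrib diff_divide_distrib)
    qed
    have "real N * \<bar>F b - F a\<bar> = (\<Sum>j<N. \<bar>F b - F a\<bar>)" by simp
    also have "\<dots> \<le> (\<Sum>j<N. F (U + real (Suc j) * s) - F (U + real j * s))"
      by (intro sum_mono le)
    also have "\<dots> = F (U + real N * s) - F U"
      by (subst sum_lessThan_telescope) simp
    also have "\<dots> \<le> F (U + 1)"
    proof -
      have "0 \<le> real N * s" using s by simp
      then have "F (U + real N * s) \<le> F (U + 1)" "0 \<le> F U"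
        using paired_positive_abs_le[OF F, of "U + real N * s" "U + 1"]
          paired_positive_abs_le[OF F, of U U] Ns by (auto simp: U_def)
      then show ?thesis by linarith
    qed
    finally show ?thesis .
  qed
  show ?thesis
    unfolding continuous_at_eps_delta
  proof (intro allI impI)
    fix e :: real assume e: "0 < e"
    obtain N :: nat where N: "F (U + 1) / e < real N" using reals_Archimedean2 by blast
    have U1: "0 \<le> F (U + 1)"
      using paired_positive_abs_le[OF F, of "U + 1" "U + 1"] by (auto simp: U_def)
    then have N0: "0 < N"
      using N e by (metis divide_nonneg_pos not_gr_zero of_nat_0 not_less)
    define d where "d = min 1 (1 / (3 * real N))"
    have "\<bar>F y - F x\<bar> < e" if y: "\<bar>y - x\<bar> < d" for y
    proof (cases "y = x")
      case False
      have "real N * \<bar>y - x\<bar> \<le> 1 / 3"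
        using y N0 by (auto simp: d_def field_simps)
      then have small: "3 * real N * \<bar>y - x\<bar> \<le> 1" "\<bar>y - x\<bar> < 1"
        using y by (auto simp: d_def)
      have "real N * \<bar>F y - F x\<bar> \<le> F (U + 1)"
      proof (cases "x < y")
        case True
        then show ?thesis using step[of x y N] small N0 by simp
      next
        case False
        then show ?thesis
          using step[of y x N] small N0 \<open>y \<noteq> x\<close> by (simp add: abs_minus_commute)
      qed
      also have "\<dots> < real N * e" using N e by (simp add: field_simps)
      finally show ?thesis using N0 by simp
    qed (use e in simp)
    moreover have "0 < d" using N0 by (auto simp: d_def)
    ultimately show "\<exists>d>0. \<forall>y. dist y x < d \<longrightarrow> dist (F y) (F x) < e"
      by (auto simp: dist_real_def)
  qed
qed

section \<open>Smoothing by averages\<close>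

lemma continuous_has_antiderivative:
  fixes F :: "real \<Rightarrow> real"
  assumes "\<And>x. isCont F x"
  obtains \<Phi> where "\<And>x. (\<Phi> has_real_derivative F x) (at x)"
  using einterval_antiderivative[of "-\<infinity>" \<infinity> F] assms
  by (auto simp: has_real_derivative_iff_has_vector_derivative)

text \<open>
  The function below is the average of \<open>F\<close> over \<open>[x, x + h]\<close>. Shifting \<open>u\<close> and \<open>v\<close> by the same
  \<open>x \<ge> 0\<close> respects \<open>\<bar>v\<bar> \<le> u\<close>, so the inequalities can be integrated over the shift. Integration
  is replaced by monotonicity of the corresponding combination of antiderivatives.
\<close>
lemma paired_positive_average:
  assumes F: "paired_positive F" and h: "0 < h"
    and \<Phi>: "\<And>x. (\<Phi> has_real_derivative F x) (at x)"
  shows "paired_positive (\<lambda>x. (\<Phi> (x + h) - \<Phi> x) / h)"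
  unfolding paired_positive_def
proof (intro allI impI, elim conjE)
  fix r :: "real poly" and u v s q :: real
  assume r: "\<forall>t\<in>{0..1}. 0 \<le> poly r t" and uv: "\<bar>v\<bar> \<le> u" and s: "0 \<le> s" and q: "0 \<le> q" "q \<le> 1"
  define L where "L f w m x = (\<Sum>k\<le>degree r. coeff r k * f (w + x + s * q ^ (2 * k + m)))"
    for f :: "real \<Rightarrow> real" and w m x
  have L': "((\<lambda>x. L \<Phi> w m x) has_real_derivative L F w m x) (at x)" for w m x
    unfolding L_def
    by (auto intro!: derivative_eq_intros DERIV_chain2[OF \<Phi>] sum.cong)
  have pos: "\<bar>L F v 1 x\<bar> \<le> L F u 0 x" if "0 \<le> x" for x
    using paired_positiveD[OF F, of r "v + x" "u + x" s q] r uv s q that by (simp add: L_def)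
  have "L \<Phi> u 0 0 - c * L \<Phi> v 1 0 \<le> L \<Phi> u 0 h - c * L \<Phi> v 1 h" if c: "\<bar>c\<bar> = 1" for c
  proof (rule DERIV_nonneg_imp_nondecreasing[where f = "\<lambda>x. L \<Phi> u 0 x - c * L \<Phi> v 1 x"])
    fix x assume x: "0 \<le> x" "x \<le> h"
    have "0 \<le> L F u 0 x - c * L F v 1 x"
      using pos[OF x(1)] c by (auto simp: abs_if split: if_splits)
    moreover have "((\<lambda>x. L \<Phi> u 0 x - c * L \<Phi> v 1 x) has_real_derivative
        L F u 0 x - c * L F v 1 x) (at x)"
      by (auto intro!: derivative_eq_intros L')
    ultimately show "\<exists>y. ((\<lambda>x. L \<Phi> u 0 x - c * L \<Phi> v 1 x) has_real_derivative y) (at x) \<and> 0 \<le> y"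
      by blast
  qed (use h in simp)
  from this[of 1] this[of "-1"]
  have "\<bar>L \<Phi> v 1 h - L \<Phi> v 1 0\<bar> \<le> L \<Phi> u 0 h - L \<Phi> u 0 0" by simp
  then have main: "\<bar>L \<Phi> v 1 h - L \<Phi> v 1 0\<bar> / h \<le> (L \<Phi> u 0 h - L \<Phi> u 0 0) / h"
    using h by (simp add: divide_right_mono)
  have eq: "(\<Sum>k\<le>degree r. coeff r k *
      ((\<Phi> (w + s * q ^ (2 * k + m) + h) - \<Phi> (w + s * q ^ (2 * k + m))) / h))
      = (L \<Phi> w m h - L \<Phi> w m 0) / h" for w m
    unfolding L_def sum_subtractf[symmetric] sum_divide_distrib
    by (intro sum.cong) (simp_all add: algebra_simps diff_divide_distrib)
  show "\<bar>\<Sum>k\<le>degree r. coeff r k *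
      ((\<Phi> (v + s * q ^ (2 * k + 1) + h) - \<Phi> (v + s * q ^ (2 * k + 1))) / h)\<bar>
    \<le> (\<Sum>k\<le>degree r. coeff r k * ((\<Phi> (u + s * q ^ (2 * k) + h) - \<Phi> (u + s * q ^ (2 * k))) / h))"
    using main h eq[of v 1] eq[of u 0] by simp
qed

text \<open>
  Iterated derivatives as an explicit sequence of functions, the form in which Taylor's theorem
  takes them.
\<close>
definition derivative_tower :: "nat \<Rightarrow> (nat \<Rightarrow> real \<Rightarrow> real) \<Rightarrow> bool" where
  "derivative_tower N D \<longleftrightarrow>
     (\<forall>k<N. \<forall>x. (D k has_real_derivative D (Suc k) x) (at x)) \<and> (\<forall>x. isCont (D N) x)"

lemma derivative_tower_isCont:
  assumes "derivative_tower N D" "k \<le> N"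
  shows "isCont (D k) x"
  using assms DERIV_isCont[of "D k" "D (Suc k) x" x] unfolding derivative_tower_def
  by (cases "k = N") auto

text \<open>
  \<open>N\<close> iterated averages. The last clause says that the smoothed function at \<open>x\<close> is a mean value of
  \<open>F\<close> over a window of length \<open>N * h\<close>; it gives both convergence and growth bounds.
\<close>
lemma paired_positive_smoothing:
  assumes F: "paired_positive F" and h: "0 < h"
  shows "\<exists>D. derivative_tower N D \<and> paired_positive (D 0) \<and>
    (\<forall>x a b. (\<forall>y\<in>{x..x + real N * h}. a \<le> F y \<and> F y \<le> b) \<longrightarrow> a \<le> D 0 x \<and> D 0 x \<le> b)"
proof (induction N)
  case 0
  show ?case
    by (rule exI[of _ "\<lambda>_. F"])
      (use F paired_positive_continuous[OF F] in \<open>auto simp: derivative_tower_def\<close>)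
next
  case (Suc N)
  then obtain D where D: "derivative_tower N D" "paired_positive (D 0)"
    and bd: "\<And>x a b. (\<And>y. y \<in> {x..x + real N * h} \<Longrightarrow> a \<le> F y \<and> F y \<le> b) \<Longrightarrow>
        a \<le> D 0 x \<and> D 0 x \<le> b" by metis
  obtain \<Phi> where \<Phi>: "\<And>x. (\<Phi> has_real_derivative D 0 x) (at x)"
    using continuous_has_antiderivative[of "D 0"] derivative_tower_isCont[OF D(1)] by blast
  define E where "E k x = (case k of 0 \<Rightarrow> (\<Phi> (x + h) - \<Phi> x) / h
      | Suc j \<Rightarrow> (D j (x + h) - D j x) / h)" for k x
  have E0: "E 0 = (\<lambda>x. (\<Phi> (x + h) - \<Phi> x) / h)"
    and ES: "\<And>j. E (Suc j) = (\<lambda>x. (D j (x + h) - D j x) / h)"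
    by (auto simp: E_def)
  have "(E k has_real_derivative E (Suc k) x) (at x)" if "k < Suc N" for k x
  proof (cases k)
    case 0
    have "((\<lambda>x. \<Phi> (x + h)) has_real_derivative D 0 (x + h)) (at x)"
      by (rule DERIV_shift[THEN iffD1]) (rule \<Phi>)
    then show ?thesis unfolding 0 E0 ES using \<Phi>
      by (intro DERIV_cdivide DERIV_diff)
  next
    case (Suc j)
    then have *: "\<And>x. (D j has_real_derivative D (Suc j) x) (at x)"
      using D(1) that by (auto simp: derivative_tower_def)
    have "((\<lambda>x. D j (x + h)) has_real_derivative D (Suc j) (x + h)) (at x)"
      by (rule DERIV_shift[THEN iffD1]) (rule *)
    then show ?thesis unfolding Suc ES using *
      by (intro DERIV_cdivide DERIV_diff)
  qed
  moreover have "isCont (E (Suc N)) x" for x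
  proof -
    have cont: "isCont (D N) y" for y by (rule derivative_tower_isCont[OF D(1) order_refl])
    have "isCont (\<lambda>x. D N (x + h)) x"
      by (rule isCont_o2[where g = "D N", OF _ cont]) simp
    then show ?thesis
      unfolding ES using h by (intro isCont_divide isCont_diff cont continuous_const) simp_all
  qed
  ultimately have "derivative_tower (Suc N) E"
    by (auto simp: derivative_tower_def)
  moreover have "paired_positive (E 0)"
    unfolding E0 by (rule paired_positive_average[OF D(2) h \<Phi>])
  moreover have "a \<le> E 0 x \<and> E 0 x \<le> b"
    if ab: "\<forall>y\<in>{x..x + real (Suc N) * h}. a \<le> F y \<and> F y \<le> b" for x a b
  proof -
    obtain z where z: "x < z" "z < x + h" "\<Phi> (x + h) - \<Phi> x = (x + h - x) * D 0 z"
      using MVT2[of x "x + h" \<Phi> "D 0"] h \<Phi> by auto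
    have "a \<le> D 0 z \<and> D 0 z \<le> b"
      by (rule bd) (use ab z h in \<open>auto simp: algebra_simps\<close>)
    then show ?thesis using z h by (simp add: E0)
  qed
  ultimately show ?case by blast
qed

section \<open>Monotonicity of the derivatives\<close>

lemma taylor_quotient_tendsto:
  assumes D: "derivative_tower n D" and y: "0 < y"
  shows "((\<lambda>s. (D 0 (x + s * y) - (\<Sum>m<n. D m x / fact m * (s * y) ^ m)) / s ^ n)
            \<longlongrightarrow> D n x / fact n * y ^ n) (at_right 0)"
proof (cases "n = 0")
  case True
  have "((\<lambda>s. D 0 (x + s * y)) \<longlongrightarrow> D 0 (x + 0 * y)) (at_right 0)"
    by (intro isCont_tendsto_compose[OF derivative_tower_isCont[OF D]] tendsto_intros) auto
  then show ?thesis using True by simp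
next
  case False
  have "\<exists>t. \<bar>t - x\<bar> \<le> s * y \<and> D 0 (x + s * y) =
      (\<Sum>m<n. D m x / fact m * (s * y) ^ m) + D n t / fact n * (s * y) ^ n" if "0 < s" for s
  proof -
    have "\<exists>t. x < t \<and> t < x + s * y \<and> D 0 (x + s * y) =
      (\<Sum>m<n. D m x / fact m * (x + s * y - x) ^ m) + D n t / fact n * (x + s * y - x) ^ n"
      using D False that y
      by (intro Taylor_up[where a = x and b = "x + s * y"]) (auto simp: derivative_tower_def)
    then obtain t where "x < t" "t < x + s * y" "D 0 (x + s * y) =
      (\<Sum>m<n. D m x / fact m * (s * y) ^ m) + D n t / fact n * (s * y) ^ n" by auto
    then show ?thesis by (intro exI[of _ t]) auto
  qed
  then have "\<forall>s. \<exists>t. 0 < s \<longrightarrow> \<bar>t - x\<bar> \<le> s * y \<and> D 0 (x + s * y) =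
      (\<Sum>m<n. D m x / fact m * (s * y) ^ m) + D n t / fact n * (s * y) ^ n" by blast
  from choice[OF this] obtain t where t: "\<And>s. 0 < s \<Longrightarrow> \<bar>t s - x\<bar> \<le> s * y"
    and eq: "\<And>s. 0 < s \<Longrightarrow> D 0 (x + s * y) =
      (\<Sum>m<n. D m x / fact m * (s * y) ^ m) + D n (t s) / fact n * (s * y) ^ n"
    by blast
  have "((\<lambda>s. s * y) \<longlongrightarrow> 0) (at_right 0)"
    by (rule tendsto_mult_left_zero) (rule tendsto_ident_at)
  then have "((\<lambda>s. t s - x) \<longlongrightarrow> 0) (at_right 0)"
    by (rule Lim_null_comparison[rotated])
      (rule eventually_mono[OF eventually_at_right_less[of 0]], simp add: t)
  then have "(t \<longlongrightarrow> x) (at_right 0)" by (simp add: LIM_zero_iff)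
  then have "((\<lambda>s. D n (t s) / fact n * y ^ n) \<longlongrightarrow> D n x / fact n * y ^ n) (at_right 0)"
    by (intro tendsto_intros isCont_tendsto_compose[OF derivative_tower_isCont[OF D]]) auto
  moreover have "\<forall>\<^sub>F s in at_right 0. D n (t s) / fact n * y ^ n =
      (D 0 (x + s * y) - (\<Sum>m<n. D m x / fact m * (s * y) ^ m)) / s ^ n"
    using eventually_at_right_less[of 0]
    by eventually_elim (simp add: eq power_mult_distrib)
  ultimately show ?thesis by (rule Lim_transform_eventually)
qed

text \<open>
  A combination of nodes that annihilates the powers below \<open>n\<close> computes, to leading order, the
  \<open>n\<close>-th derivative.
\<close>
lemma divided_combination_tendsto:
  fixes c y :: "nat \<Rightarrow> real"
  assumes D: "derivative_tower n D" and y: "\<And>k. 0 < y k"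
    and annihilates: "\<And>m. m < n \<Longrightarrow> (\<Sum>k\<le>K. c k * y k ^ m) = 0"
  shows "((\<lambda>s. (\<Sum>k\<le>K. c k * D 0 (x + s * y k)) / s ^ n)
            \<longlongrightarrow> D n x / fact n * (\<Sum>k\<le>K. c k * y k ^ n)) (at_right 0)"
proof -
  let ?T = "\<lambda>s k. \<Sum>m<n. D m x / fact m * (s * y k) ^ m"
  have "((\<lambda>s. \<Sum>k\<le>K. c k * ((D 0 (x + s * y k) - ?T s k) / s ^ n))
      \<longlongrightarrow> (\<Sum>k\<le>K. c k * (D n x / fact n * y k ^ n))) (at_right 0)"
    by (intro tendsto_intros taylor_quotient_tendsto D y)
  moreover have "(\<Sum>k\<le>K. c k * ((D 0 (x + s * y k) - ?T s k) / s ^ n))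
      = (\<Sum>k\<le>K. c k * D 0 (x + s * y k)) / s ^ n" for s
  proof -
    have "(\<Sum>k\<le>K. c k * ?T s k) = (\<Sum>k\<le>K. \<Sum>m<n. D m x / fact m * s ^ m * (c k * y k ^ m))"
      by (simp add: sum_distrib_left power_mult_distrib mult_ac)
    also have "\<dots> = (\<Sum>m<n. D m x / fact m * s ^ m * (\<Sum>k\<le>K. c k * y k ^ m))"
      by (subst sum.swap) (simp add: sum_distrib_left)
    also have "\<dots> = 0" by (simp add: annihilates)
    finally have "(\<Sum>k\<le>K. c k * (D 0 (x + s * y k) - ?T s k)) = (\<Sum>k\<le>K. c k * D 0 (x + s * y k))"
      by (simp add: right_diff_distrib sum_subtractf)
    then show ?thesis by (simp add: sum_divide_distrib[symmetric])
  qed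
  moreover have "(\<Sum>k\<le>K. c k * (D n x / fact n * y k ^ n)) = D n x / fact n * (\<Sum>k\<le>K. c k * y k ^ n)"
    by (simp add: sum_distrib_left mult_ac)
  ultimately show ?thesis by simp
qed

text \<open>
  The square in the test polynomial \<open>r\<close> makes it non-negative, and its roots \<open>1, q\<^sup>2, \<dots>\<close> are
  exactly what the Taylor terms of order below \<open>n\<close> see. At order \<open>n\<close> it takes the positive value
  \<open>\<rho>\<close> on both sides, with an extra factor \<open>q ^ n\<close> for the odd moments that disappears
  as \<open>q \<rightarrow> 1\<close>.
\<close>
lemma paired_positive_derivative_abs_le:
  assumes D: "derivative_tower n D" and F: "paired_positive (D 0)" and uv: "\<bar>v\<bar> \<le> u"
  shows "\<bar>D n v\<bar> \<le> D n u"
proof -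
  have bound: "q ^ n * \<bar>D n v\<bar> \<le> D n u" if q: "0 < q" "q < 1" for q
  proof -
    define r where "r = (\<Prod>i<n. [:- (q ^ (2 * i)), 1:] ^ 2)"
    have r: "poly r t = (\<Prod>i<n. (t - q ^ (2 * i)) ^ 2)" for t
      unfolding r_def poly_prod poly_power by (rule prod.cong) simp_all
    have sum: "(\<Sum>k\<le>degree r. coeff r k * (q ^ (2 * k + j)) ^ m) = q ^ (j * m) * poly r (q ^ (2 * m))" for j m
    proof -
      have "(q ^ (2 * k + j)) ^ m = q ^ (j * m) * (q ^ (2 * m)) ^ k" for k
        by (simp add: power_mult[symmetric] power_add[symmetric] algebra_simps)
      then show ?thesis by (simp add: poly_altdef sum_distrib_left mult_ac)
    qed
    have zero: "poly r (q ^ (2 * m)) = 0" if "m < n" for m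
      using that by (auto simp: r)
    define \<rho> where "\<rho> = poly r (q ^ (2 * n))"
    have \<rho>: "0 < \<rho>"
      unfolding \<rho>_def r
    proof (intro prod_pos ballI)
      fix i assume "i \<in> {..<n}"
      then have "q ^ (2 * n) < q ^ (2 * i)" using q by (intro power_strict_decreasing) auto
      then show "0 < (q ^ (2 * n) - q ^ (2 * i)) ^ 2" by simp
    qed
    have lim: "((\<lambda>s. (\<Sum>k\<le>degree r. coeff r k * D 0 (x + s * q ^ (2 * k + j))) / s ^ n)
        \<longlongrightarrow> D n x / fact n * (q ^ (j * n) * \<rho>)) (at_right 0)" for x j
      using divided_combination_tendsto[OF D, where y = "\<lambda>k. q ^ (2 * k + j)" and K = "degree r" and c = "coeff r" and x = x] q zero sum
      by (simp add: \<rho>_def)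
    have "\<bar>D n v / fact n * (q ^ (1 * n) * \<rho>)\<bar> \<le> D n u / fact n * (q ^ (0 * n) * \<rho>)"
    proof (rule tendsto_le[OF _ lim tendsto_rabs[OF lim]])
      show "\<forall>\<^sub>F s in at_right 0. \<bar>(\<Sum>k\<le>degree r. coeff r k * D 0 (v + s * q ^ (2 * k + 1))) / s ^ n\<bar>
          \<le> (\<Sum>k\<le>degree r. coeff r k * D 0 (u + s * q ^ (2 * k + 0))) / s ^ n"
        using eventually_at_right_less[of 0]
      proof eventually_elim
        case (elim s)
        then have "\<bar>\<Sum>k\<le>degree r. coeff r k * D 0 (v + s * q ^ (2 * k + 1))\<bar>
          \<le> (\<Sum>k\<le>degree r. coeff r k * D 0 (u + s * q ^ (2 * k)))"
          using q uv by (intro paired_positiveD[OF F]) (auto simp: r intro!: prod_nonneg)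
        then show ?case using elim by (simp add: divide_right_mono)
      qed
    qed simp
    then have "(q ^ n * \<bar>D n v\<bar>) * (\<rho> / fact n) \<le> D n u * (\<rho> / fact n)"
      using q \<rho> by (simp add: abs_mult mult_ac)
    then show ?thesis by (rule mult_right_le_imp_le) (use \<rho> in simp)
  qed
  have "((\<lambda>q. q ^ n * \<bar>D n v\<bar>) \<longlongrightarrow> 1 ^ n * \<bar>D n v\<bar>) (at_left 1)"
    by (intro tendsto_intros)
  moreover have "\<forall>\<^sub>F q in at_left 1. q ^ n * \<bar>D n v\<bar> \<le> D n u"
    by (rule eventually_mono[OF eventually_at_left_real[of 0 1]]) (auto intro: bound)
  ultimately show ?thesis
    by (metis tendsto_upperbound trivial_limit_at_left_real mult_1 power_one)
qed

text \<open>
  The remainder at \<open>x\<close> is at most \<open>D N \<bar>x\<bar> * \<bar>x\<bar> ^ N / N!\<close>. In the expansion of \<open>D 0\<close> about \<open>\<bar>x\<bar>\<close>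
  with step \<open>R = 2 * \<bar>x\<bar> + 1\<close> all terms are non-negative, so \<open>D N \<bar>x\<bar> * R ^ N / N!\<close> is at most
  \<open>D 0 (\<bar>x\<bar> + R)\<close>; the factor \<open>(\<bar>x\<bar> / R) ^ N \<le> (1 / 2) ^ N\<close> remains.
\<close>
lemma maclaurin_approximation:
  assumes D: "derivative_tower N D" and F: "paired_positive (D 0)"
  shows "0 \<le> x \<Longrightarrow> (\<Sum>n<N. D n 0 / fact n * x ^ n) \<le> D 0 x"
    and "\<bar>D 0 x - (\<Sum>n<N. D n 0 / fact n * x ^ n)\<bar> \<le> (1 / 2) ^ N * D 0 (3 * \<bar>x\<bar> + 1)"
    and "n \<le> N \<Longrightarrow> 0 \<le> D n 0"
proof -
  have tower: "derivative_tower n D" if "n \<le> N" for n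
    using that D derivative_tower_isCont[OF D] by (auto simp: derivative_tower_def)
  have le: "\<bar>D n v\<bar> \<le> D n u" if "n \<le> N" "\<bar>v\<bar> \<le> u" for n u v
    using paired_positive_derivative_abs_le[OF tower F] that by blast
  have nonneg: "0 \<le> D n u" if "n \<le> N" "0 \<le> u" for n u
    using le[of n u u] that by linarith
  then show "n \<le> N \<Longrightarrow> 0 \<le> D n 0" by simp
  have mac: "\<exists>t. \<bar>t\<bar> \<le> \<bar>x\<bar> \<and> (0 \<le> x \<longrightarrow> 0 \<le> t) \<and>
      D 0 x = (\<Sum>n<N. D n 0 / fact n * x ^ n) + D N t / fact N * x ^ N" for x
  proof (cases "N = 0 \<or> x = 0")
    case True
    then show ?thesis
      by (cases N) (auto intro!: exI[of _ x] simp: power_0_left sum.lessThan_Suc_shift simp del: sum.lessThan_Suc)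
  next
    case False
    have "\<exists>t. (if x < 0 then x < t \<and> t < 0 else 0 < t \<and> t < x) \<and>
      D 0 x = (\<Sum>m<N. D m 0 / fact m * (x - 0) ^ m) + D N t / fact N * (x - 0) ^ N"
      using False D
      by (intro Taylor[where a = "-\<bar>x\<bar>" and b = "\<bar>x\<bar>"]) (auto simp: derivative_tower_def)
    then obtain t where "if x < 0 then x < t \<and> t < 0 else 0 < t \<and> t < x"
      "D 0 x = (\<Sum>m<N. D m 0 / fact m * x ^ m) + D N t / fact N * x ^ N" by auto
    then show ?thesis by (intro exI[of _ t]) (auto split: if_splits)
  qed
  show "(\<Sum>n<N. D n 0 / fact n * x ^ n) \<le> D 0 x" if "0 \<le> x"
  proof -
    from mac[of x] obtain t where "0 \<le> x \<longrightarrow> 0 \<le> t"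
      and eq: "D 0 x = (\<Sum>n<N. D n 0 / fact n * x ^ n) + D N t / fact N * x ^ N"
      by (elim exE conjE)
    then have "0 \<le> D N t / fact N * x ^ N"
      using nonneg[of N t] that by simp
    with eq show ?thesis by linarith
  qed
  define R where "R = 2 * \<bar>x\<bar> + 1"
  have top: "D N \<bar>x\<bar> / fact N * R ^ N \<le> D 0 (3 * \<bar>x\<bar> + 1)"
  proof (cases "N = 0")
    case True
    then show ?thesis using le[of 0 "\<bar>x\<bar>" "3 * \<bar>x\<bar> + 1"] by auto
  next
    case False
    have "\<exists>t. \<bar>x\<bar> < t \<and> t < \<bar>x\<bar> + R \<and> D 0 (\<bar>x\<bar> + R) =
      (\<Sum>m<N. D m \<bar>x\<bar> / fact m * (\<bar>x\<bar> + R - \<bar>x\<bar>) ^ m) + D N t / fact N * (\<bar>x\<bar> + R - \<bar>x\<bar>) ^ N"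
      using False D
      by (intro Taylor_up[where a = "\<bar>x\<bar>" and b = "\<bar>x\<bar> + R"]) (auto simp: derivative_tower_def R_def)
    then obtain t where t: "\<bar>x\<bar> < t" and eq: "D 0 (\<bar>x\<bar> + R) =
      (\<Sum>m<N. D m \<bar>x\<bar> / fact m * R ^ m) + D N t / fact N * R ^ N" by auto
    have "0 \<le> (\<Sum>m<N. D m \<bar>x\<bar> / fact m * R ^ m)"
      by (intro sum_nonneg mult_nonneg_nonneg divide_nonneg_nonneg nonneg) (auto simp: R_def)
    moreover have "D N \<bar>x\<bar> / fact N * R ^ N \<le> D N t / fact N * R ^ N"
      using le[of N "\<bar>x\<bar>" t] t by (intro mult_right_mono divide_right_mono) (auto simp: R_def)
    moreover have "\<bar>x\<bar> + R = 3 * \<bar>x\<bar> + 1" by (simp add: R_def)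
    ultimately show ?thesis using eq by simp
  qed
  obtain t where t: "\<bar>t\<bar> \<le> \<bar>x\<bar>"
    and eq: "D 0 x = (\<Sum>n<N. D n 0 / fact n * x ^ n) + D N t / fact N * x ^ N"
    using mac[of x] by (elim exE conjE)
  have "\<bar>D 0 x - (\<Sum>n<N. D n 0 / fact n * x ^ n)\<bar> = \<bar>D N t\<bar> / fact N * \<bar>x\<bar> ^ N"
    using eq by (simp add: abs_mult power_abs)
  also have "\<dots> \<le> D N \<bar>x\<bar> / fact N * (R / 2) ^ N"
    using le[of N t "\<bar>x\<bar>"] t nonneg[of N "\<bar>x\<bar>"]
    by (intro mult_mono divide_right_mono power_mono) (auto simp: R_def)
  also have "\<dots> = (1 / 2) ^ N * (D N \<bar>x\<bar> / fact N * R ^ N)" by (simp add: power_divide)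
  also have "\<dots> \<le> (1 / 2) ^ N * D 0 (3 * \<bar>x\<bar> + 1)"
    by (intro mult_left_mono top) simp
  finally show "\<bar>D 0 x - (\<Sum>n<N. D n 0 / fact n * x ^ n)\<bar> \<le> (1 / 2) ^ N * D 0 (3 * \<bar>x\<bar> + 1)" .
qed

section \<open>Passage to an entire limit\<close>

lemma higher_deriv_polynomial_at_0:
  fixes a :: "nat \<Rightarrow> complex"
  shows "(deriv ^^ n) (\<lambda>z. \<Sum>k<N. a k * z ^ k) 0 / fact n = (if n < N then a n else 0)"
proof -
  have "(\<lambda>z. \<Sum>k<N. a k * z ^ k) has_fps_expansion (\<Sum>k<N. fps_const (a k) * fps_X ^ k)"
    by (induction N)
      (simp_all add: has_fps_expansion_add has_fps_expansion_cmult_left has_fps_expansion_fps_X_power)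
  then have "(deriv ^^ n) (\<lambda>z. \<Sum>k<N. a k * z ^ k) 0 / fact n
      = fps_nth (\<Sum>k<N. fps_const (a k) * fps_X ^ k) n"
    by (rule fps_nth_fps_expansion[symmetric])
  also have "\<dots> = (\<Sum>k<N. if k = n then a k else 0)"
    unfolding fps_sum_nth by (intro sum.cong) (simp_all add: fps_X_power_nth)
  also have "\<dots> = (if n < N then a n else 0)" by simp
  finally show ?thesis .
qed

text \<open>
  The polynomials \<open>P N\<close> are the Maclaurin polynomials of the \<open>N\<close>-fold averages. Non-negative
  coefficients give \<open>norm (P N z) \<le> P N (norm z)\<close>, so the values on the positive half-line
  control the whole plane, as Montel's theorem requires.
\<close>
theorem paired_positive_imp_abs_monotonic_entire:
  assumes F: "paired_positive F"
  shows "abs_monotonic_entire F"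
proof -
  have mono: "F a \<le> F b" if "0 \<le> a" "a \<le> b" for a b
    using paired_positive_abs_le[OF F, of a b] that by force
  \<comment> \<open>the window of \<open>N\<close> averages of length \<open>h N\<close> shrinks to a point\<close>
  define h where "h N = 1 / real (Suc N) ^ 2" for N
  have h: "0 < h N" for N by (simp add: h_def)
  have Nh: "real N * h N \<le> 1 / real (Suc N)" for N
  proof -
    have "real N * h N \<le> real (Suc N) * h N" using h[of N] by (intro mult_right_mono) auto
    also have "\<dots> = 1 / real (Suc N)" by (simp add: h_def power2_eq_square)
    finally show ?thesis .
  qed
  have Nh1: "real N * h N \<le> 1" for N
    using Nh[of N] by (rule order_trans) simp
  have "\<forall>N. \<exists>D. derivative_tower N D \<and> paired_positive (D 0) \<and>
    (\<forall>x a b. (\<forall>y\<in>{x..x + real N * h N}. a \<le> F y \<and> F y \<le> b) \<longrightarrow> a \<le> D 0 x \<and> D 0 x \<le> b)"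
    using paired_positive_smoothing[OF F h] by blast
  from choice[OF this] obtain D
    where D: "\<And>N. derivative_tower N (D N)" "\<And>N. paired_positive (D N 0)"
    and window: "\<And>N x a b. (\<And>y. y \<in> {x..x + real N * h N} \<Longrightarrow> a \<le> F y \<and> F y \<le> b) \<Longrightarrow>
        a \<le> D N 0 x \<and> D N 0 x \<le> b"
    by blast
  have D_le: "D N 0 x \<le> F (x + 1)" if x: "0 \<le> x" for N x
  proof -
    have "0 \<le> D N 0 x \<and> D N 0 x \<le> F (x + 1)"
    proof (rule window)
      fix y assume y: "y \<in> {x..x + real N * h N}"
      then show "0 \<le> F y \<and> F y \<le> F (x + 1)"
        using x Nh1[of N] mono[of y "x + 1"] paired_positive_abs_le[OF F, of y y] by auto
    qed
    then show ?thesis by simp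
  qed
  have D_lim: "(\<lambda>N. D N 0 x) \<longlonglongrightarrow> F x" for x
  proof (rule LIMSEQ_I)
    fix e :: real assume e: "0 < e"
    obtain d where d: "0 < d" "\<And>y. \<bar>y - x\<bar> < d \<Longrightarrow> \<bar>F y - F x\<bar> < e / 2"
      using paired_positive_continuous[OF F, of x] e
      unfolding continuous_at_eps_delta dist_real_def by (meson half_gt_zero)
    obtain N0 where N0: "1 / real (Suc N0) < d"
      using nat_approx_posE[OF d(1)] by blast
    have "norm (D N 0 x - F x) < e" if N: "N0 \<le> N" for N
    proof -
      have "1 / real (Suc N) \<le> 1 / real (Suc N0)" using N by (simp add: frac_le)
      then have less: "real N * h N < d" using Nh[of N] N0 by linarith
      have "F x - e / 2 \<le> D N 0 x \<and> D N 0 x \<le> F x + e / 2"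
      proof (rule window)
        fix y assume "y \<in> {x..x + real N * h N}"
        then have "\<bar>F y - F x\<bar> < e / 2" using less by (intro d) auto
        then show "F x - e / 2 \<le> F y \<and> F y \<le> F x + e / 2" by linarith
      qed
      then show ?thesis using e unfolding real_norm_def by linarith
    qed
    then show "\<exists>N0. \<forall>N\<ge>N0. norm (D N 0 x - F x) < e" by blast
  qed
  define c where "c N n = D N n 0 / fact n" for N n
  have c: "0 \<le> c N n" if "n < N" for N n
    using maclaurin_approximation(3)[where D = "D N" and n = n, OF D] that by (simp add: c_def)
  define P where "P N z = (\<Sum>n<N. of_real (c N n) * z ^ n)" for N and z :: complex
  have P_real: "P N (of_real x) = of_real (\<Sum>n<N. c N n * x ^ n)" for N x
    by (simp add: P_def)
  have P_lim: "(\<lambda>N. P N (of_real x)) \<longlonglongrightarrow> of_real (F x)" for x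
  proof -
    have "(\<lambda>N. (1 / 2) ^ N * F (3 * \<bar>x\<bar> + 1 + 1)) \<longlonglongrightarrow> 0"
      by (rule tendsto_mult_left_zero) (rule LIMSEQ_power_zero, simp)
    then have "(\<lambda>N. D N 0 x - (\<Sum>n<N. c N n * x ^ n)) \<longlonglongrightarrow> 0"
    proof (rule Lim_null_comparison[OF always_eventually, rotated], intro allI)
      fix N
      have "\<bar>D N 0 x - (\<Sum>n<N. c N n * x ^ n)\<bar> \<le> (1 / 2) ^ N * D N 0 (3 * \<bar>x\<bar> + 1)"
        using maclaurin_approximation(2)[where D = "D N" and x = x, OF D] by (simp add: c_def)
      also have "\<dots> \<le> (1 / 2) ^ N * F (3 * \<bar>x\<bar> + 1 + 1)"
        by (intro mult_left_mono D_le) auto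
      finally show "norm (D N 0 x - (\<Sum>n<N. c N n * x ^ n)) \<le> (1 / 2) ^ N * F (3 * \<bar>x\<bar> + 1 + 1)"
        by simp
    qed
    from tendsto_diff[OF D_lim[of x] this] show ?thesis
      unfolding P_real by (intro tendsto_of_real) simp
  qed
  have P_bound: "norm (P N z) \<le> F (norm z + 1)" for N z
  proof -
    have "norm (P N z) \<le> (\<Sum>n<N. norm (of_real (c N n) * z ^ n))"
      unfolding P_def by (rule norm_sum)
    also have "\<dots> = (\<Sum>n<N. c N n * norm z ^ n)"
      using c by (intro sum.cong) (auto simp: norm_mult norm_power)
    also have "\<dots> \<le> D N 0 (norm z)"
      using maclaurin_approximation(1)[where D = "D N" and x = "norm z", OF D] by (simp add: c_def)
    also have "\<dots> \<le> F (norm z + 1)" by (rule D_le) simp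
    finally show ?thesis .
  qed
  have P_holo: "P N holomorphic_on A" for N A
    unfolding P_def by (intro holomorphic_intros)
  have P_locally_bounded: "\<exists>B. \<forall>g\<in>range P. \<forall>z\<in>K. norm (g z) \<le> B" if "compact K" for K
  proof -
    from compact_imp_bounded[OF that] obtain B where B: "\<forall>z\<in>K. norm z \<le> B"
      unfolding bounded_iff by (elim exE)
    have "norm (P N z) \<le> F (B + 1)" if "z \<in> K" for N z
    proof -
      have "norm z \<le> B" using B that by (rule bspec)
      then show ?thesis
        using P_bound[of N z] mono[of "norm z + 1" "B + 1"] by simp
    qed
    then show ?thesis by (intro exI[of _ "F (B + 1)"]) auto
  qed
  have range_P_holo: "g holomorphic_on UNIV" if "g \<in> range P" for g
    using that P_holo by (elim imageE) simp
  obtain f \<phi> where f: "f holomorphic_on UNIV" and \<phi>: "strict_mono \<phi>"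
    and lim: "\<And>z. z \<in> UNIV \<Longrightarrow> (\<lambda>N. P (\<phi> N) z) \<longlonglongrightarrow> f z"
    and unif: "\<And>K. compact K \<Longrightarrow> K \<subseteq> UNIV \<Longrightarrow> uniform_limit K (P \<circ> \<phi>) f sequentially"
  proof (rule Montel[OF open_UNIV range_P_holo P_locally_bounded subset_refl])
    fix g \<psi>
    assume "g holomorphic_on UNIV" "strict_mono \<psi>"
      "\<And>z. z \<in> UNIV \<Longrightarrow> (\<lambda>N. P (\<psi> N) z) \<longlonglongrightarrow> g z"
      "\<And>K. compact K \<Longrightarrow> K \<subseteq> UNIV \<Longrightarrow> uniform_limit K (P \<circ> \<psi>) g sequentially"
    then show thesis by (rule that)
  qed
  have "f (of_real x) = of_real (F x)" for x
    using LIMSEQ_unique[OF lim[OF UNIV_I] LIMSEQ_subseq_LIMSEQ[OF P_lim \<phi>, unfolded o_def]] .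
  moreover have "(deriv ^^ n) f 0 / fact n \<in> \<real>\<^sub>\<ge>\<^sub>0" for n
  proof -
    have "uniform_limit (ball 0 1) (P \<circ> \<phi>) f sequentially"
      by (rule uniform_limit_on_subset[OF unif[OF compact_cball[of 0 1]]]) auto
    then have "(\<lambda>N. (deriv ^^ n) ((P \<circ> \<phi>) N) 0) \<longlonglongrightarrow> (deriv ^^ n) f 0"
      by (rule higher_deriv_complex_uniform_limit) (simp_all add: P_holo)
    then have "(\<lambda>N. (deriv ^^ n) (P (\<phi> N)) 0 / fact n) \<longlonglongrightarrow> (deriv ^^ n) f 0 / fact n"
      by (intro tendsto_intros) (auto simp: o_def)
    moreover have "(deriv ^^ n) (P N) 0 / fact n \<in> \<real>\<^sub>\<ge>\<^sub>0" for N
    proof -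
      have "(deriv ^^ n) (P N) 0 / fact n = (if n < N then of_real (c N n) else 0)"
        unfolding P_def by (rule higher_deriv_polynomial_at_0)
      then show ?thesis using c[of n N] by (simp add: nonneg_Reals_of_real_iff)
    qed
    ultimately show ?thesis
      by (rule closed_sequentially[OF closed_nonneg_Reals_complex, rotated])
  qed
  ultimately show ?thesis unfolding abs_monotonic_entire_def using f by blast
qed

section \<open>Monomials on the cube\<close>

lemma monomial_measurable [measurable]: "monomial \<alpha> \<in> borel_measurable borel"
  unfolding monomial_def by (intro borel_measurable_continuous_onI continuous_intros)

lemma monomial_zero: "monomial 0 x = 1"
  by (simp add: monomial_def)

lemma monomial_one: "monomial \<alpha> 1 = 1"
  by (simp add: monomial_def)

lemma monomial_mult: "monomial \<alpha> (x * y) = monomial \<alpha> x * monomial \<alpha> y"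
  by (simp add: monomial_def power_mult_distrib prod.distrib)

lemma monomial_vec: "monomial \<alpha> (vec t) = t ^ (\<Sum>i\<in>UNIV. \<alpha> $ i)"
  by (simp add: monomial_def power_sum)

lemma monomial_axis: "monomial (axis i k) x = (x $ i) ^ k"
proof -
  have "monomial (axis i k) x = (\<Prod>j\<in>UNIV. if j = i then (x $ j) ^ k else 1)"
    unfolding monomial_def by (intro prod.cong) (auto simp: axis_def)
  then show ?thesis by simp
qed

lemma monomial_abs_le_1:
  assumes "x \<in> unit_cube"
  shows "\<bar>monomial \<alpha> x\<bar> \<le> 1"
proof -
  have "\<bar>x $ i\<bar> \<le> 1" for i using assms by (auto simp: unit_cube_def abs_le_iff)
  then show ?thesis
    unfolding monomial_def abs_prod power_abs
    by (intro prod_le_1) (auto intro: power_le_one)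
qed

lemma unit_cube_mult:
  assumes "x \<in> unit_cube" "y \<in> unit_cube"
  shows "x * y \<in> unit_cube"
proof -
  have "\<bar>(x * y) $ i\<bar> \<le> 1" for i
  proof -
    have "\<bar>x $ i\<bar> \<le> 1" "\<bar>y $ i\<bar> \<le> 1" using assms by (auto simp: unit_cube_def abs_le_iff)
    then show ?thesis by (simp add: abs_mult mult_le_one)
  qed
  then show ?thesis by (auto simp: unit_cube_def abs_le_iff minus_le_iff)
qed

lemma unit_cube_borel [measurable]: "(unit_cube :: (real ^ 'd::finite) set) \<in> sets borel"
proof -
  have "(unit_cube :: (real ^ 'd) set) = cbox (vec (-1)) (vec 1 :: real ^ 'd)"
    by (auto simp: unit_cube_def mem_box_cart)
  then show ?thesis by (metis borel_closed closed_cbox)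
qed

lemma vec_mult_measurable [measurable]:
  "(\<lambda>(x, y). x * y :: real ^ 'd::finite) \<in> borel \<Otimes>\<^sub>M borel \<rightarrow>\<^sub>M borel"
proof -
  have "continuous_on UNIV (\<lambda>p :: (real ^ 'd) \<times> (real ^ 'd). \<chi> i. fst p $ i * snd p $ i)"
    by (intro continuous_intros)
  then have "continuous_on UNIV (\<lambda>(x, y). x * y :: real ^ 'd)"
    by (simp add: case_prod_unfold times_vec_def)
  then show ?thesis
    unfolding borel_prod by (rule borel_measurable_continuous_onI)
qed

lemma integrable_monomial_cube:
  assumes "finite_measure M" "sets M = sets borel" "AE x in M. x \<in> unit_cube"
  shows "integrable M (monomial \<alpha>)"
  using assms(3) monomial_measurable
  by (intro finite_measure.integrable_const_bound[OF assms(1), of _ 1])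
    (auto elim!: eventually_mono simp: monomial_abs_le_1 measurable_cong_sets[OF assms(2) refl])

section \<open>Mixtures of multiplicative convolution powers\<close>

fun mult_power :: "(real ^ 'd::finite) measure \<Rightarrow> nat \<Rightarrow> (real ^ 'd) measure" where
  "mult_power S 0 = return borel 1"
| "mult_power S (Suc n) = distr (mult_power S n \<Otimes>\<^sub>M S) borel (\<lambda>(x, y). x * y)"

text \<open>
  The power is the law of a product of \<open>n\<close> independent factors (up to total mass), so
  multiplicativity of monomials and Fubini's theorem give the moments.
\<close>
lemma mult_power:
  fixes S :: "(real ^ 'd::finite) measure"
  assumes S: "subprob_space S" "sets S = sets borel" "AE x in S. x \<in> unit_cube"
  shows "sets (mult_power S n) = sets borel \<and> subprob_space (mult_power S n) \<and>
    (AE x in mult_power S n. x \<in> unit_cube) \<and>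
    (\<integral>x. monomial \<alpha> x \<partial>mult_power S n) = (\<integral>x. monomial \<alpha> x \<partial>S) ^ n"
proof (induction n)
  case 0
  have "subprob_space (return borel (1 :: real ^ 'd))"
    by (intro prob_space_imp_subprob_space prob_space_return) simp
  moreover have "AE x in return borel (1 :: real ^ 'd). x \<in> unit_cube"
    by (subst AE_return) (auto simp: unit_cube_def)
  moreover have "(\<integral>x. monomial \<alpha> x \<partial>return borel 1) = 1"
    by (subst integral_return) (auto simp: monomial_one)
  ultimately show ?case unfolding mult_power.simps by simp
next
  case (Suc n)
  let ?N = "mult_power S n"
  have N: "sets ?N = sets borel" "subprob_space ?N" "AE x in ?N. x \<in> unit_cube"
    and eq: "(\<integral>x. monomial \<alpha> x \<partial>?N) = (\<integral>x. monomial \<alpha> x \<partial>S) ^ n"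
    using Suc.IH by auto
  note [measurable_cong] = N(1) S(2)
  interpret N: subprob_space ?N by fact
  interpret S: subprob_space S by fact
  interpret NS: pair_sigma_finite ?N S ..
  have m [measurable]: "(\<lambda>(x, y). x * y) \<in> ?N \<Otimes>\<^sub>M S \<rightarrow>\<^sub>M borel"
    using vec_mult_measurable by measurable
  have cube: "AE p in ?N \<Otimes>\<^sub>M S. fst p * snd p \<in> unit_cube"
  proof (rule NS.AE_pair_measure)
    have "(\<lambda>p. fst p * snd p) \<in> ?N \<Otimes>\<^sub>M S \<rightarrow>\<^sub>M borel"
      using m by (simp add: case_prod_unfold)
    then show "{p \<in> space (?N \<Otimes>\<^sub>M S). fst p * snd p \<in> unit_cube} \<in> sets (?N \<Otimes>\<^sub>M S)"
      by measurable
    show "AE x in ?N. AE y in S. fst (x, y) * snd (x, y) \<in> unit_cube"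
      using N(3)
    proof eventually_elim
      case (elim x)
      show ?case using S(3) by eventually_elim (use elim in \<open>auto intro: unit_cube_mult\<close>)
    qed
  qed
  have sub: "subprob_space (?N \<Otimes>\<^sub>M S)"
  proof (rule subprob_spaceI)
    have "emeasure ?N (space ?N) * emeasure S (space S) \<le> 1 * 1"
      by (intro mult_mono N.emeasure_space_le_1 S.emeasure_space_le_1) auto
    then show "emeasure (?N \<Otimes>\<^sub>M S) (space (?N \<Otimes>\<^sub>M S)) \<le> 1"
      by (simp add: space_pair_measure S.emeasure_pair_measure_Times)
    show "space (?N \<Otimes>\<^sub>M S) \<noteq> {}"
      using N.subprob_not_empty S.subprob_not_empty by (simp add: space_pair_measure)
  qed
  then have "subprob_space (mult_power S (Suc n))"
    by (simp add: subprob_space.subprob_space_distr)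
  moreover have "AE x in mult_power S (Suc n). x \<in> unit_cube"
    unfolding mult_power.simps
    by (subst AE_distr_iff[OF m]) (use cube in \<open>simp_all add: case_prod_unfold\<close>)
  moreover have "(\<integral>x. monomial \<alpha> x \<partial>mult_power S (Suc n)) = (\<integral>x. monomial \<alpha> x \<partial>S) ^ Suc n"
  proof -
    have int: "integrable (?N \<Otimes>\<^sub>M S) (\<lambda>p. monomial \<alpha> (fst p * snd p))"
    proof -
      have "finite_measure (?N \<Otimes>\<^sub>M S)"
        using sub by (simp add: subprob_space_def)
      moreover have "(\<lambda>p. monomial \<alpha> (fst p * snd p)) \<in> borel_measurable (?N \<Otimes>\<^sub>M S)"
        using measurable_compose[OF m monomial_measurable] by (simp add: case_prod_unfold)
      ultimately show ?thesis
        using cube by (intro finite_measure.integrable_const_bound[of _ _ 1])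
          (auto elim!: eventually_mono simp: monomial_abs_le_1)
    qed
    have "(\<integral>x. monomial \<alpha> x \<partial>mult_power S (Suc n)) = (\<integral>p. monomial \<alpha> (fst p * snd p) \<partial>(?N \<Otimes>\<^sub>M S))"
      by (simp add: integral_distr case_prod_unfold)
    also have "\<dots> = (\<integral>x. \<integral>y. monomial \<alpha> x * monomial \<alpha> y \<partial>S \<partial>?N)"
      by (subst NS.integral_fst'[OF int, symmetric]) (simp add: monomial_mult)
    also have "\<dots> = (\<integral>x. monomial \<alpha> x \<partial>S) ^ Suc n"
      by (simp add: eq)
    finally show ?thesis .
  qed
  ultimately show ?case by simp
qed

text \<open>
  The weighted sum of the measures \<open>mult_power S n\<close> with weights \<open>w n\<close>, written as a monadic bind
  so that integrals and null sets of the sum are available.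
\<close>
definition multiplicative_mixture ::
    "(nat \<Rightarrow> real) \<Rightarrow> (real ^ 'd::finite) measure \<Rightarrow> (real ^ 'd) measure" where
  "multiplicative_mixture w S = density (count_space UNIV) (\<lambda>n. ennreal (w n)) \<bind> mult_power S"

text \<open>
  The termwise integration formula for the mixture is about non-negative integrands. Monomials
  change sign but are at least \<open>-1\<close> on the cube, so the proof integrates \<open>1 + monomial \<alpha>\<close> and
  subtracts the total mass.
\<close>
lemma multiplicative_mixture:
  fixes S :: "(real ^ 'd::finite) measure"
  assumes S: "subprob_space S" "sets S = sets borel" "AE x in S. x \<in> unit_cube"
    and w: "\<And>n. 0 \<le> w n"
    and G: "\<And>t. (\<lambda>n. w n * t ^ n) sums G t"
  defines "T \<equiv> multiplicative_mixture w S"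
  shows "admissible T" "supported_on T unit_cube" "moment T \<alpha> = G (moment S \<alpha>)"
proof -
  note P = mult_power[OF S]
  let ?W = "density (count_space UNIV) (\<lambda>n. ennreal (w n))"
  have kernel: "mult_power S \<in> ?W \<rightarrow>\<^sub>M subprob_algebra borel"
    using P by (auto simp: measurable_count_space_eq1 space_subprob_algebra
        cong: measurable_cong_sets)
  have T: "sets T = sets borel"
    unfolding T_def multiplicative_mixture_def
    by (rule sets_bind[where N = borel]) (use P in auto)
  have nn: "(\<integral>\<^sup>+x. f x \<partial>T) = (\<Sum>n. ennreal (w n) * (\<integral>\<^sup>+x. f x \<partial>mult_power S n))"
    if [measurable]: "f \<in> borel_measurable borel" for f
    unfolding T_def multiplicative_mixture_def
    by (subst nn_integral_bind[OF that kernel])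
      (simp add: nn_integral_density nn_integral_count_space_nat)
  have ae: "AE x in T. x \<in> unit_cube"
    unfolding T_def multiplicative_mixture_def
    by (subst AE_bind[OF kernel]) (use P in auto)
  have int_power: "integrable (mult_power S n) (monomial \<alpha>)" for n \<alpha>
    using P by (intro integrable_monomial_cube) (auto simp: subprob_space_def)
  have monomial_0: "monomial 0 = (\<lambda>x. 1)"
    by (simp add: fun_eq_iff monomial_zero)
  have int1: "integrable (mult_power S n) (\<lambda>x. 1 :: real)" for n
    using int_power[of n 0] unfolding monomial_0 .
  \<comment> \<open>\<open>a = 0\<close> yields the total mass, \<open>a = 1\<close> the moments\<close>
  have sum1: "(\<integral>\<^sup>+x. ennreal (1 + a * monomial \<alpha> x) \<partial>T) = ennreal (G (moment S 0) + a * G (moment S \<alpha>))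
      \<and> 0 \<le> G (moment S 0) + a * G (moment S \<alpha>)" if a: "0 \<le> a" "a \<le> 1" for a \<alpha>
  proof -
    let ?m = "\<lambda>n. moment S 0 ^ n + a * moment S \<alpha> ^ n"
    have eq: "(\<integral>\<^sup>+x. ennreal (1 + a * monomial \<alpha> x) \<partial>mult_power S n) = ennreal (?m n)"
      and nonneg: "0 \<le> ?m n" for n
    proof -
      have pos: "AE x in mult_power S n. 0 \<le> 1 + a * monomial \<alpha> x"
      proof -
        have "0 \<le> 1 + a * monomial \<alpha> x" if "x \<in> unit_cube" for x
        proof -
          have "\<bar>a * monomial \<alpha> x\<bar> \<le> 1"
            unfolding abs_mult using a monomial_abs_le_1[OF that, of \<alpha>] by (intro mult_le_one) auto
          then show ?thesis by linarith
        qed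
        moreover have "AE x in mult_power S n. x \<in> unit_cube" using P by blast
        ultimately show ?thesis by (rule eventually_mono[rotated])
      qed
      have int: "integrable (mult_power S n) (\<lambda>x. 1 + a * monomial \<alpha> x)"
        using int1 int_power by (intro Bochner_Integration.integrable_add integrable_mult_right)
      have "(\<integral>x. 1 + a * monomial \<alpha> x \<partial>mult_power S n) =
          (\<integral>x. monomial 0 x \<partial>mult_power S n) + a * (\<integral>x. monomial \<alpha> x \<partial>mult_power S n)"
        using int1[of n] int_power[of n \<alpha>] unfolding monomial_0
        by (subst Bochner_Integration.integral_add) auto
      also have "\<dots> = ?m n" using P[of n] unfolding moment_def by metis
      finally have m: "(\<integral>x. 1 + a * monomial \<alpha> x \<partial>mult_power S n) = ?m n" .
      show "(\<integral>\<^sup>+x. ennreal (1 + a * monomial \<alpha> x) \<partial>mult_power S n) = ennreal (?m n)"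
        using nn_integral_eq_integral[OF int pos] m by simp
      show "0 \<le> ?m n" using integral_nonneg_AE[OF pos] m by simp
    qed
    have sums: "(\<lambda>n. w n * ?m n) sums (G (moment S 0) + a * G (moment S \<alpha>))"
      using sums_add[OF G sums_mult[OF G], of "moment S 0" a "moment S \<alpha>"] by (simp add: algebra_simps)
    have "(\<integral>\<^sup>+x. ennreal (1 + a * monomial \<alpha> x) \<partial>T) = (\<Sum>n. ennreal (w n * ?m n))"
      using w nonneg by (subst nn) (auto simp: eq ennreal_mult)
    also have "\<dots> = ennreal (G (moment S 0) + a * G (moment S \<alpha>))"
      by (rule suminf_ennreal_eq[OF _ sums]) (intro mult_nonneg_nonneg w nonneg)
    finally show ?thesis
      using sums_le[OF _ sums_zero sums] w nonneg by auto
  qed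
  have mass: "emeasure T (space T) = ennreal (G (moment S 0))" "0 \<le> G (moment S 0)"
    using sum1[of 0 0] by simp_all
  then have fin: "finite_measure T" by (intro finite_measureI) simp
  have int: "integrable T (monomial \<alpha>)" for \<alpha>
    by (rule integrable_monomial_cube) fact+
  then show "admissible T" using T by (simp add: admissible_def)
  show "supported_on T unit_cube" using ae by (simp add: supported_on_def)
  have "(\<integral>x. 1 + monomial \<alpha> x \<partial>T) = enn2real (\<integral>\<^sup>+x. ennreal (1 + monomial \<alpha> x) \<partial>T)"
  proof (rule integral_eq_nn_integral)
    show "AE x in T. 0 \<le> 1 + monomial \<alpha> x"
      using ae by eventually_elim (use monomial_abs_le_1[of _ \<alpha>] in force)
  qed (simp add: measurable_cong_sets[OF T refl])
  also have "\<dots> = G (moment S 0) + G (moment S \<alpha>)"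
    using sum1[of 1 \<alpha>] by simp
  also have "(\<integral>x. 1 + monomial \<alpha> x \<partial>T) = measure T (space T) + moment T \<alpha>"
    using int[of \<alpha>] int[of 0] unfolding monomial_0 moment_def
    by (subst Bochner_Integration.integral_add) auto
  also have "measure T (space T) = G (moment S 0)"
    using mass by (simp add: measure_def)
  finally show "moment T \<alpha> = G (moment S \<alpha>)" by simp
qed

lemma finite_measure_admissible:
  fixes M :: "(real ^ 'd::finite) measure"
  assumes "admissible M"
  shows "finite_measure M"
proof -
  have "integrable M (monomial 0)" using assms by (simp add: admissible_def)
  then have "integrable M (\<lambda>x. 1 :: real)" by (simp add: monomial_zero[abs_def])
  then show ?thesis by (intro finite_measureI) (auto simp: integrable_iff_bounded)
qed

text \<open>
  The kernel of the mixture must consist of subprobability measures, so \<open>M\<close> is divided by a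
  constant \<open>C\<close> exceeding its mass; the weights \<open>c n * C ^ n\<close> compensate for this.
\<close>
theorem abs_monotonic_entire_preserves_moment_families:
  assumes F: "abs_monotonic_entire F"
    and s: "s \<in> moment_families (unit_cube :: (real ^ 'd::finite) set)"
  shows "entrywise F s \<in> moment_families (unit_cube :: (real ^ 'd) set)"
proof -
  obtain f where f: "f holomorphic_on UNIV" "\<And>x. f (complex_of_real x) = complex_of_real (F x)"
    "\<And>n. (deriv ^^ n) f 0 / fact n \<in> \<real>\<^sub>\<ge>\<^sub>0"
    using F unfolding abs_monotonic_entire_def by blast
  define c where "c n = Re ((deriv ^^ n) f 0 / fact n)" for n
  have c: "0 \<le> c n" "complex_of_real (c n) = (deriv ^^ n) f 0 / fact n" for n
    using f(3)[of n] by (auto simp: c_def complex_nonneg_Reals_iff complex_eq_iff)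
  have F_sums: "(\<lambda>n. c n * x ^ n) sums F x" for x
  proof -
    have "(\<lambda>n. (deriv ^^ n) f 0 / fact n * (of_real x - 0) ^ n) sums f (of_real x)"
      by (rule holomorphic_power_series[where r = "\<bar>x\<bar> + 1"])
        (auto intro: holomorphic_on_subset[OF f(1)])
    then have "(\<lambda>n. complex_of_real (c n * x ^ n)) sums complex_of_real (F x)"
      by (simp add: c f(2))
    then show ?thesis by (simp only: sums_of_real_iff)
  qed
  obtain M :: "(real ^ 'd) measure" where M: "admissible M" "supported_on M unit_cube" "s = moment M"
    using s unfolding moment_families_def by blast
  interpret M: finite_measure M using M(1) by (rule finite_measure_admissible)
  have M_sets: "sets M = sets borel" using M(1) by (simp add: admissible_def)
  define C where "C = measure M (space M) + 1"
  have C: "0 < C" by (simp add: C_def add_nonneg_pos)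
  define S where "S = density M (\<lambda>_. ennreal (1 / C))"
  have S_sets: "sets S = sets borel" by (simp add: S_def M_sets)
  have S_cube: "AE x in S. x \<in> unit_cube"
    using M(2) unfolding S_def supported_on_def by (subst AE_density) auto
  have S_sub: "subprob_space S"
  proof (rule subprob_spaceI)
    have "emeasure S (space S) = ennreal (1 / C) * emeasure M (space M)"
      by (simp add: S_def emeasure_density nn_integral_cmult)
    also have "\<dots> = ennreal (measure M (space M) / C)"
      using C by (simp add: M.emeasure_eq_measure ennreal_mult' flip: ennreal_mult'')
    also have "\<dots> \<le> 1" using C by (simp add: C_def)
    finally show "emeasure S (space S) \<le> 1" .
    show "space S \<noteq> {}" using sets_eq_imp_space_eq[OF M_sets] by (simp add: S_def)
  qed
  have S_moment: "moment S \<alpha> = moment M \<alpha> / C" for \<alpha>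
    using C unfolding moment_def S_def
    by (subst integral_density) (auto simp: measurable_cong_sets[OF M_sets refl])
  let ?T = "multiplicative_mixture (\<lambda>n. c n * C ^ n) S"
  have w: "0 \<le> c n * C ^ n" for n using c C by simp
  have G: "(\<lambda>n. c n * C ^ n * t ^ n) sums F (C * t)" for t
    using F_sums[of "C * t"] by (simp add: power_mult_distrib mult_ac)
  note T = multiplicative_mixture[OF S_sub S_sets S_cube w G]
  have "moment ?T = entrywise F s"
    using C by (simp add: fun_eq_iff T(3) entrywise_def S_moment M(3))
  then show ?thesis
    using T(1,2) unfolding moment_families_def by (smt (verit) mem_Collect_eq)
qed

section \<open>Three-point test measures\<close>

text \<open>
  On the diagonal a monomial depends only on the total degree \<open>k\<close>, and the masses at \<open>1\<close> and \<open>-1\<close>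
  contribute their sum \<open>u\<close> to even moments and their difference \<open>v\<close> to odd ones.
\<close>
lemma three_point_moments:
  fixes u v s q :: real
  assumes uv: "\<bar>v\<bar> \<le> u" and s: "0 \<le> s" and q: "0 \<le> q" "q \<le> 1"
  shows "(\<lambda>\<alpha>. let k = \<Sum>i\<in>UNIV. \<alpha> $ i in (if even k then u else v) + s * q ^ k)
    \<in> moment_families (unit_cube :: (real ^ 'd::finite) set)"
proof -
  define w where "w i = (if i = 0 then (u + v) / 2 else if i = 1 then (u - v) / 2 else s)" for i :: nat
  define p where "p i = (if i = 0 then 1 else if i = 1 then -1 else q)" for i :: nat
  define X where "X = point_measure {0, 1, 2} (\<lambda>i. ennreal (w i))"
  define M :: "(real ^ 'd) measure" where "M = distr X borel (\<lambda>i. vec (p i))"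
  have w: "0 \<le> w i" for i using uv s by (auto simp: w_def abs_le_iff)
  have X_measurable: "g \<in> borel_measurable X" for g :: "nat \<Rightarrow> real"
    by (simp add: X_def)
  have X_vec [measurable]: "(\<lambda>i. vec (p i) :: real ^ 'd) \<in> X \<rightarrow>\<^sub>M borel"
    by (simp add: X_def)
  have "admissible M"
    unfolding admissible_def M_def
    by (auto simp: integrable_distr_eq X_def integrable_point_measure_finite)
  moreover have "supported_on M unit_cube"
    unfolding supported_on_def M_def
    by (subst AE_distr_iff)
      (use q in \<open>auto simp: X_def AE_point_measure p_def unit_cube_def\<close>)
  moreover have "moment M \<alpha> = (let k = \<Sum>i\<in>UNIV. \<alpha> $ i in (if even k then u else v) + s * q ^ k)" for \<alpha>
  proof -
    have "moment M \<alpha> = (\<Sum>i\<in>{0, 1, 2}. w i * p i ^ (\<Sum>j\<in>UNIV. \<alpha> $ j))"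
      unfolding moment_def M_def
      by (simp add: integral_distr monomial_vec X_def lebesgue_integral_point_measure_finite w)
    moreover have "(u + v) / 2 + (u - v) / 2 = u" "(u + v) / 2 + (v - u) / 2 = v"
      by (simp_all add: field_simps)
    ultimately show ?thesis by (simp add: Let_def w_def p_def)
  qed
  ultimately show ?thesis
    unfolding moment_families_def by (auto intro!: exI[of _ M])
qed

text \<open>
  Only moments along one coordinate axis of the representing measure \<open>\<sigma>\<close> are needed: they integrate
  \<open>r (t\<^sup>2) * (1 \<plusminus> t)\<close>, which is non-negative for \<open>t\<close> in \<open>[-1, 1]\<close>.
\<close>
theorem preserves_moment_families_imp_paired_positive:
  assumes H: "\<And>s. s \<in> moment_families (unit_cube :: (real ^ 'd::finite) set) \<Longrightarrow>
    entrywise F s \<in> moment_families (unit_cube :: (real ^ 'd) set)"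
  shows "paired_positive F"
  unfolding paired_positive_def
proof (intro allI impI, elim conjE)
  fix r :: "real poly" and u v s q :: real
  assume r: "\<forall>t\<in>{0..1}. 0 \<le> poly r t" and uv: "\<bar>v\<bar> \<le> u" and s: "0 \<le> s" and q: "0 \<le> q" "q \<le> 1"
  obtain \<sigma> :: "(real ^ 'd) measure" where \<sigma>: "admissible \<sigma>" "supported_on \<sigma> unit_cube"
    and moment: "\<And>\<alpha>. moment \<sigma> \<alpha> =
      F (let k = \<Sum>i\<in>UNIV. \<alpha> $ i in (if even k then u else v) + s * q ^ k)"
  proof -
    obtain \<sigma> :: "(real ^ 'd) measure" where \<sigma>: "admissible \<sigma>" "supported_on \<sigma> unit_cube"
      and eq: "entrywise F (\<lambda>\<alpha>. let k = \<Sum>i\<in>UNIV. \<alpha> $ i in (if even k then u else v) + s * q ^ k) = moment \<sigma>"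
      using H[OF three_point_moments[OF uv s q]] unfolding moment_families_def mem_Collect_eq
      by (elim exE conjE)
    from fun_cong[OF eq] have "moment \<sigma> \<alpha> =
      F (let k = \<Sum>i\<in>UNIV. \<alpha> $ i in (if even k then u else v) + s * q ^ k)" for \<alpha>
      unfolding entrywise_def by (rule sym)
    with \<sigma> show thesis by (rule that)
  qed
  define i :: 'd where "i = undefined"
  have int: "integrable \<sigma> (\<lambda>x. (x $ i) ^ k)" for k
    using \<sigma>(1) unfolding admissible_def by (simp flip: monomial_axis)
  have mom: "(\<integral>x. (x $ i) ^ k \<partial>\<sigma>) = F ((if even k then u else v) + s * q ^ k)" for k
  proof -
    have "(\<Sum>j\<in>UNIV. axis i k $ j) = k" by (simp add: axis_def)
    then show ?thesis using moment[of "axis i k"] by (simp add: moment_def monomial_axis)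
  qed
  define A where "A = (\<Sum>k\<le>degree r. coeff r k * F (u + s * q ^ (2 * k)))"
  define B where "B = (\<Sum>k\<le>degree r. coeff r k * F (v + s * q ^ (2 * k + 1)))"
  have "0 \<le> A + c * B" if c: "\<bar>c\<bar> = 1" for c
  proof -
    have "0 \<le> (\<integral>x. poly r ((x $ i)\<^sup>2) * (1 + c * x $ i) \<partial>\<sigma>)"
    proof (rule integral_nonneg_AE)
      have "0 \<le> poly r ((x $ i)\<^sup>2) * (1 + c * x $ i)" if "x \<in> unit_cube" for x
      proof -
        have x: "\<bar>x $ i\<bar> \<le> 1" using that by (auto simp: unit_cube_def abs_le_iff)
        then have "0 \<le> poly r ((x $ i)\<^sup>2)" using r by (simp add: abs_square_le_1)
        moreover have "\<bar>c * x $ i\<bar> \<le> 1" using x c by (simp add: abs_mult)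
        ultimately show ?thesis by (intro mult_nonneg_nonneg) linarith+
      qed
      then show "AE x in \<sigma>. 0 \<le> poly r ((x $ i)\<^sup>2) * (1 + c * x $ i)"
        using \<sigma>(2) unfolding supported_on_def by (rule eventually_mono[rotated])
    qed
    also have "\<dots> = (\<integral>x. (\<Sum>k\<le>degree r. coeff r k * (x $ i) ^ (2 * k) +
        c * (coeff r k * (x $ i) ^ (2 * k + 1))) \<partial>\<sigma>)"
      by (intro Bochner_Integration.integral_cong refl)
        (simp add: poly_altdef sum.distrib sum_distrib_left algebra_simps flip: power_mult)
    also have "\<dots> = (\<Sum>k\<le>degree r. coeff r k * F (u + s * q ^ (2 * k)) +
        c * (coeff r k * F (v + s * q ^ (2 * k + 1))))"
    proof (subst Bochner_Integration.integral_sum)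
      show "integrable \<sigma> (\<lambda>x. coeff r k * (x $ i) ^ (2 * k) + c * (coeff r k * (x $ i) ^ (2 * k + 1)))" for k
        by (intro Bochner_Integration.integrable_add integrable_mult_right int)
      have "(\<integral>x. coeff r k * (x $ i) ^ (2 * k) + c * (coeff r k * (x $ i) ^ (2 * k + 1)) \<partial>\<sigma>)
        = coeff r k * F (u + s * q ^ (2 * k)) + c * (coeff r k * F (v + s * q ^ (2 * k + 1)))" for k
        using mom[of "2 * k"] mom[of "2 * k + 1"]
        by (subst Bochner_Integration.integral_add)
          (auto intro!: integrable_mult_right int simp del: power_Suc)
      then show "(\<Sum>k\<le>degree r. \<integral>x. coeff r k * (x $ i) ^ (2 * k) + c * (coeff r k * (x $ i) ^ (2 * k + 1)) \<partial>\<sigma>)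
        = (\<Sum>k\<le>degree r. coeff r k * F (u + s * q ^ (2 * k)) + c * (coeff r k * F (v + s * q ^ (2 * k + 1))))"
        by simp
    qed
    also have "\<dots> = A + c * B"
      by (simp add: A_def B_def sum.distrib sum_distrib_left)
    finally show ?thesis .
  qed
  from this[of 1] this[of "-1"] have "\<bar>B\<bar> \<le> A" by linarith
  then show "\<bar>\<Sum>k\<le>degree r. coeff r k * F (v + s * q ^ (2 * k + 1))\<bar>
      \<le> (\<Sum>k\<le>degree r. coeff r k * F (u + s * q ^ (2 * k)))"
    by (simp add: A_def B_def)
qed

theorem theorem9p1:
  fixes F :: "real \<Rightarrow> real"
  shows "entrywise F ` (moment_families (unit_cube :: (real ^ 'd::finite) set))
           \<subseteq> moment_families (unit_cube :: (real ^ 'd) set)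
         \<longleftrightarrow> abs_monotonic_entire F"
  by (meson paired_positive_imp_abs_monotonic_entire preserves_moment_families_imp_paired_positive
      abs_monotonic_entire_preserves_moment_families image_subset_iff)

end
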